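(* Let $\alpha\in(0,1)$ and let $D_1=\{z\in\mathbb{C}:|z|<1\}$ and $\overline{D}_1=\{z\in\mathbb{C}:|z|\le1\}$. Suppose $h:\overline{D}_1\to\mathbb{C}$ is continuous, and that on the set $\{z:|z|<1,\ h(z)\neq0\}$, $h$ has continuous (first-order real) partial derivatives and satisfies $$\frac{\partial h}{\partial\bar z}=|h|^\alpha.$$ If $h(0)\neq0$, then $\sup|h|>S_\alpha$ (the supremum being over the unit disk $D_1$), where the constant $S_\alpha>0$ is defined by $$S_\alpha=\begin{cases}\left(\alpha(1-\alpha)\right)^{1/(2-2\alpha)}&\text{if }0<\alpha\le\frac23,\\[4pt]\left(\dfrac{4\alpha(1-\alpha)^2}{2-\alpha}\right)^{1/(2-2\alpha)}&\text{if }\frac23\le\alpha<1.\end{cases}$$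
   Context: Here $z=x+iy$ and $\frac{\partial}{\partial\bar z}=\frac12\left(\frac{\partial}{\partial x}+i\frac{\partial}{\partial y}\right)$. *)

theory Defs
  imports "HOL-Analysis.Analysis"
begin

definition partial_x :: "(complex \<Rightarrow> complex) \<Rightarrow> complex \<Rightarrow> complex" where
  "partial_x f z = vector_derivative (\<lambda>t::real. f (z + of_real t)) (at 0)"

definition partial_y :: "(complex \<Rightarrow> complex) \<Rightarrow> complex \<Rightarrow> complex" where
  "partial_y f z = vector_derivative (\<lambda>t::real. f (z + \<i> * of_real t)) (at 0)"

(* vector_derivative is total, so existence of the partial derivatives is required separately
   from their continuity.  The derivatives are two-sided: U is meant to be open. *)
definition has_continuous_partials_on :: "(complex \<Rightarrow> complex) \<Rightarrow> complex set \<Rightarrow> bool" where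
  "has_continuous_partials_on f U \<longleftrightarrow>
     (\<forall>z\<in>U. (\<lambda>t::real. f (z + of_real t)) differentiable (at 0)) \<and>
     (\<forall>z\<in>U. (\<lambda>t::real. f (z + \<i> * of_real t)) differentiable (at 0)) \<and>
     continuous_on U (partial_x f) \<and> continuous_on U (partial_y f)"

definition dbar :: "(complex \<Rightarrow> complex) \<Rightarrow> complex \<Rightarrow> complex" where
  "dbar f z = (1/2) * (partial_x f z + \<i> * partial_y f z)"

definition S_const :: "real \<Rightarrow> real" where
  "S_const \<alpha> =
     (if \<alpha> \<le> 2/3 then (\<alpha> * (1 - \<alpha>)) powr (1 / (2 - 2 * \<alpha>))
      else (4 * \<alpha> * (1 - \<alpha>)^2 / (2 - \<alpha>)) powr (1 / (2 - 2 * \<alpha>)))"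

(* The two formulas agree at 2/3, so the second one is valid there as well. *)
lemma S_const_ge:
  assumes "2/3 \<le> \<alpha>"
  shows "S_const \<alpha> = (4 * \<alpha> * (1 - \<alpha>)^2 / (2 - \<alpha>)) powr (1 / (2 - 2 * \<alpha>))"
proof (cases "\<alpha> = 2/3")
  case True
  then have "\<alpha> * (1 - \<alpha>) = 4 * \<alpha> * (1 - \<alpha>)^2 / (2 - \<alpha>)"
    unfolding True by (simp add: power2_eq_square)
  then show ?thesis by (simp add: S_const_def)
next
  case False
  with assms show ?thesis by (simp add: S_const_def)
qed

lemma S_const_pos: "0 < \<alpha> \<Longrightarrow> \<alpha> < 1 \<Longrightarrow> 0 < S_const \<alpha>"
  by (simp add: S_const_def)

end

theory Submission
  imports Defs
begin

text \<open>
  Put p = 2 - 2\<alpha> and C = S powr p for the constant S of the theorem.  If |h| were bounded by S, then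
  |h| powr p - C|z|^2 would be at most 0 for |z| = 1 and where h = 0, and positive at 0, so it would attain
  its maximum t > 0 at an interior point z0 with h(z0) nonzero.  Near z0 the function
  k = log(h(z0 + z)/h(z0)) satisfies dbar k = \<phi> exp(\<alpha> Re k - k), and Re k lies below a multiple of
  log(C|z0 + z|^2 + t) with contact at 0.  Comparing circle means of both sides to second order gives an
  inequality at z0 that fails for every C \<le> ((2 - 2\<alpha>)/(2 - \<alpha>))^2, in particular for this one.
  As h is only once differentiable, no Laplacian is used: the second-order behaviour of the circle means of k
  is read off from the first-order expansion of dbar k.
\<close>

section \<open>Wirtinger derivatives and real differentiability\<close>

definition wirtinger_dz :: "(complex \<Rightarrow> complex) \<Rightarrow> complex \<Rightarrow> complex" where
  "wirtinger_dz f z = (1/2) * (partial_x f z - \<i> * partial_y f z)"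

lemma vector_derivative_translate:
  fixes f :: "real \<Rightarrow> 'a::real_normed_vector"
  assumes "(f has_vector_derivative f') (at 0)"
  shows "((\<lambda>t. f (t - a)) has_vector_derivative f') (at a)"
proof -
  have "((\<lambda>t. t - a) has_derivative (\<lambda>h. h)) (at a)"
    by (auto intro!: derivative_eq_intros)
  moreover have "(f has_derivative (\<lambda>h. h *\<^sub>R f')) (at (a - a))"
    using assms by (simp add: has_vector_derivative_def)
  ultimately show ?thesis
    unfolding has_vector_derivative_def using diff_chain_at by (fastforce simp: o_def)
qed

text \<open>The criterion of continuous partial derivatives, applied on a rectangle around
  \<open>z\<close> in real coordinates and carried back to the complex plane. The resulting
  real-linear map is then split into its complex-linear and antilinear parts.\<close>

lemma has_derivative_wirtinger:
  assumes U: "open U" and f: "has_continuous_partials_on f U" and z: "z \<in> U"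
  shows "(f has_derivative (\<lambda>w. wirtinger_dz f z * w + dbar f z * cnj w)) (at z)"
proof -
  obtain d where d: "d > 0" "ball z d \<subseteq> U"
    using U z open_contains_ball by blast
  \<comment> \<open>Half-sides \<open>d/2\<close> keep the rectangle inside \<open>ball z d\<close>,
    because the modulus is at most the sum of the two coordinate distances.\<close>
  define X where "X = {Re z - d/2 <..< Re z + d/2}"
  define Y where "Y = {Im z - d/2 <..< Im z + d/2}"
  have XY: "Complex x y \<in> U" if "x \<in> X" "y \<in> Y" for x y
  proof -
    have "cmod (Complex x y - z) \<le> \<bar>x - Re z\<bar> + \<bar>y - Im z\<bar>"
      using cmod_le[of "Complex x y - z"] by simp
    also have "\<dots> < d" using that unfolding X_def Y_def by (auto simp: abs_if)
    finally show ?thesis using d by (auto simp: dist_norm norm_minus_commute)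
  qed
  have fx: "((\<lambda>x. f (Complex x (Im z))) has_derivative (\<lambda>t. t *\<^sub>R partial_x f z)) (at (Re z) within X)"
  proof -
    have "((\<lambda>t::real. f (z + of_real t)) has_vector_derivative partial_x f z) (at 0)"
      using f z unfolding has_continuous_partials_on_def partial_x_def vector_derivative_works by blast
    from vector_derivative_translate[OF this, of "Re z"]
    have "((\<lambda>x. f (z + of_real (x - Re z))) has_vector_derivative partial_x f z) (at (Re z))"
      by simp
    moreover have "z + of_real (x - Re z) = Complex x (Im z)" for x by (simp add: complex_eq_iff)
    ultimately show ?thesis
      unfolding has_vector_derivative_def by (simp add: has_derivative_at_withinI)
  qed
  \<comment> \<open>The criterion needs continuity of the y-derivative as a bounded linear operator,
    hence the form with \<open>blinfun_scaleR_left\<close>.\<close>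
  have fy: "((\<lambda>y. f (Complex x y)) has_derivative blinfun_apply (blinfun_scaleR_left (partial_y f (Complex x y)))) (at y within Y)"
    if "x \<in> X" "y \<in> Y" for x y
  proof -
    let ?z = "Complex x y"
    have "((\<lambda>t::real. f (?z + \<i> * of_real t)) has_vector_derivative partial_y f ?z) (at 0)"
      using f XY[OF that] unfolding has_continuous_partials_on_def partial_y_def vector_derivative_works by blast
    from vector_derivative_translate[OF this, of y]
    have "((\<lambda>t. f (?z + \<i> * of_real (t - y))) has_vector_derivative partial_y f ?z) (at y)"
      by simp
    moreover have "?z + \<i> * of_real (t - y) = Complex x t" for t by (simp add: complex_eq_iff)
    ultimately show ?thesis
      unfolding has_vector_derivative_def by (simp add: has_derivative_at_withinI)
  qed
  have cont: "continuous_on (X \<times> Y) (\<lambda>p. partial_y f (Complex (fst p) (snd p)))"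
  proof (rule continuous_on_compose2[where g="partial_y f"])
    show "continuous_on U (partial_y f)" using f by (simp add: has_continuous_partials_on_def)
    show "continuous_on (X \<times> Y) (\<lambda>p. Complex (fst p) (snd p))"
      unfolding Complex_eq by (intro continuous_intros)
  qed (use XY in auto)
  have "continuous_on (X \<times> Y) (\<lambda>(x, y). blinfun_scaleR_left (partial_y f (Complex x y)))"
    unfolding split_beta by (intro continuous_intros cont)
  moreover have zin: "Re z \<in> X" "Im z \<in> Y" using d by (auto simp: X_def Y_def)
  ultimately have c: "continuous (at (Re z, Im z) within X \<times> Y) (\<lambda>(x, y). blinfun_scaleR_left (partial_y f (Complex x y)))"
    by (simp add: continuous_on_eq_continuous_within)
  have "((\<lambda>(x, y). f (Complex x y)) has_derivative
      (\<lambda>(tx, ty). tx *\<^sub>R partial_x f z + blinfun_apply (blinfun_scaleR_left (partial_y f (Complex (Re z) (Im z)))) ty))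
      (at (Re z, Im z) within X \<times> Y)"
    by (rule has_derivative_partialsI[OF fx fy c]) (use zin in \<open>auto simp: Y_def\<close>)
  moreover have "open (X \<times> Y)" by (auto simp: X_def Y_def intro!: open_Times)
  ultimately have D: "((\<lambda>(x, y). f (Complex x y)) has_derivative
      (\<lambda>(tx, ty). tx *\<^sub>R partial_x f z + ty *\<^sub>R partial_y f z)) (at (Re z, Im z))"
    using zin by (simp add: at_within_open[of "(Re z, Im z)" "X \<times> Y"])
  have "((\<lambda>w. (Re w, Im w)) has_derivative (\<lambda>w. (Re w, Im w))) (at z)"
    by (auto intro!: derivative_eq_intros)
  from diff_chain_at[OF this D] 
  have "(f has_derivative (\<lambda>w. Re w *\<^sub>R partial_x f z + Im w *\<^sub>R partial_y f z)) (at z)"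
    by (simp add: o_def)
  moreover have "wirtinger_dz f z * w + dbar f z * cnj w = Re w *\<^sub>R partial_x f z + Im w *\<^sub>R partial_y f z" for w
    by (simp add: complex_eq_iff wirtinger_dz_def dbar_def) (simp add: field_simps)
  ultimately show ?thesis by simp
qed

section \<open>Circle means and their second-order behaviour\<close>

lemma integral_cis_multiple:
  "n \<noteq> 0 \<Longrightarrow> ((\<lambda>t. cis (of_int n * t)) has_integral 0) {0..2*pi}"
proof -
  assume n: "n \<noteq> 0"
  let ?F = "\<lambda>t. cis (of_int n * t) / (\<i> * of_int n)"
  have "((\<lambda>t. cis (of_int n * t)) has_integral (?F (2*pi) - ?F 0)) {0..2*pi}"
    using n by (intro fundamental_theorem_of_calculus)
      (auto simp: cis_conv_exp scaleR_conv_of_real field_simps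
        intro!: derivative_eq_intros has_vector_derivative_real_field)
  moreover have "cis (of_int n * (2*pi)) = 1"
    using cis_multiple_2pi[of "of_int n"] by (simp add: mult_ac)
  ultimately show ?thesis by simp
qed

text \<open>
  With J(r) the integral of k over the circle of radius r in the angle t, the fact that
  d/dt k(r cis t) integrates to 0 turns the A-part of J'(r) into its B-part, so
  J'(r) = 4 \<pi> r B1 + o(r) without any differentiability of A.
\<close>

lemma Re_wirtinger_le_of_quadratic_bound:
  fixes k A B :: "complex \<Rightarrow> complex"
  assumes \<rho>: "\<rho> > 0"
    and k: "\<And>z. z \<in> ball 0 \<rho> \<Longrightarrow> (k has_derivative (\<lambda>w. A z * w + B z * cnj w)) (at z)"
    and A: "continuous_on (ball 0 \<rho>) A" and B: "continuous_on (ball 0 \<rho>) B"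
    and B': "(B has_derivative (\<lambda>w. B1 * w + B2 * cnj w)) (at 0)"
    and E: "\<And>z. z \<in> ball 0 \<rho> \<Longrightarrow> Re (k z) \<le> Re (k 0) + E * (cmod z)\<^sup>2"
  shows "Re B1 \<le> E"
proof (rule ccontr)
  assume "\<not> Re B1 \<le> E"
  \<comment> \<open>Half the gap: an error of \<open>4 * pi * \<delta> * r\<close> in
    \<open>J'\<close> uses up only half of the excess
    \<open>4 * pi * r * (Re B1 - E)\<close>.\<close>
  define \<delta> where "\<delta> = (Re B1 - E) / 2"
  have \<delta>: "\<delta> > 0" using \<open>\<not> Re B1 \<le> E\<close> by (simp add: \<delta>_def)
  obtain d where d: "d > 0" and Bd: "\<And>z. cmod z < d \<Longrightarrow> cmod (B z - B 0 - (B1 * z + B2 * cnj z)) \<le> \<delta> * cmod z"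
  proof -
    obtain d where "d > 0" "\<forall>y. cmod (y - 0) < d \<longrightarrow> cmod (B y - B 0 - (B1 * (y - 0) + B2 * cnj (y - 0))) \<le> \<delta> * cmod (y - 0)"
      using B' \<delta> unfolding has_derivative_at_alt by blast
    with that show ?thesis by simp
  qed
  define r0 where "r0 = min \<rho> d / 2"
  have r0: "r0 > 0" "r0 < \<rho>" "r0 < d" using \<rho> d by (auto simp: r0_def)
  have inb: "of_real r * cis t \<in> ball 0 \<rho>" if "r \<in> {0..r0}" for r t
    using that r0 by (simp add: norm_mult)
  have circ: "continuous_on S (\<lambda>t. F (of_real r * cis t))" 
    if "continuous_on (ball 0 \<rho>) F" "r \<in> {0..r0}" for F :: "complex \<Rightarrow> complex" and r S
    by (rule continuous_on_compose2[OF that(1)]) (use inb that in \<open>auto intro!: continuous_intros\<close>)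
  have kc: "continuous_on (ball 0 \<rho>) k"
    using k has_derivative_continuous by (blast intro: continuous_at_imp_continuous_on)
  define J where "J = (\<lambda>r. integral {0..2*pi} (\<lambda>t. k (of_real r * cis t)))"
  define J' where "J' = (\<lambda>r. integral {0..2*pi} (\<lambda>t. A (of_real r * cis t) * cis t + B (of_real r * cis t) * cis (-t)))"
  have JJ': "(J has_vector_derivative J' r) (at r within {0..r0})" if r: "r \<in> {0..r0}" for r
    unfolding J_def J'_def cbox_interval[of 0 "2*pi", symmetric]
  proof (rule leibniz_rule_vector_derivative)
    fix x t :: real assume x: "x \<in> {0..r0}"
    have "((\<lambda>x. of_real x * cis t) has_derivative (\<lambda>h. of_real h * cis t)) (at x)"
      by (auto intro!: derivative_eq_intros)
    from diff_chain_at[OF this k[OF inb[OF x]]]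
    have "((\<lambda>x. k (of_real x * cis t)) has_vector_derivative
            A (of_real x * cis t) * cis t + B (of_real x * cis t) * cis (-t)) (at x)"
      unfolding has_vector_derivative_def o_def 
      by (rule has_derivative_eq_rhs) (simp add: fun_eq_iff scaleR_conv_of_real cis_cnj algebra_simps)
    thus "((\<lambda>x. k (of_real x * cis t)) has_vector_derivative
            A (of_real x * cis t) * cis t + B (of_real x * cis t) * cis (-t)) (at x within {0..r0})"
      by (rule has_vector_derivative_at_within)
  next
    show "(\<lambda>t. k (of_real x * cis t)) integrable_on cbox 0 (2*pi)" if "x \<in> {0..r0}" for x
      by (intro integrable_continuous circ kc that)
    have "continuous_on ({0..r0} \<times> cbox 0 (2*pi)) (\<lambda>p. F (of_real (fst p) * cis (snd p)))"
      if "continuous_on (ball 0 \<rho>) F" for F :: "complex \<Rightarrow> complex"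
      by (rule continuous_on_compose2[OF that]) (use inb in \<open>auto intro!: continuous_intros\<close>)
    from this[OF A] this[OF B]
    show "continuous_on ({0..r0} \<times> cbox 0 (2*pi))
      (\<lambda>(x, t). A (of_real x * cis t) * cis t + B (of_real x * cis t) * cis (-t))"
      unfolding split_beta by (intro continuous_intros)
  qed (use r in auto)
  have Re_J': "Re (J' r) \<ge> 4 * pi * r * Re B1 - 4 * pi * \<delta> * r" if r: "r \<in> {0<..r0}" for r
  proof -
    have r': "r \<in> {0..r0}" using r by auto
    define I where "I = integral {0..2*pi} (\<lambda>t. B (of_real r * cis t) * cis (-t))"
    have iB: "((\<lambda>t. B (of_real r * cis t) * cis (-t)) has_integral I) {0..2*pi}"
      unfolding I_def by (intro integrable_integral integrable_continuous_interval continuous_intros circ B r')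
    have iA: "(\<lambda>t. A (of_real r * cis t) * cis t) integrable_on {0..2*pi}"
      by (intro integrable_continuous_interval continuous_intros circ A r')
    have cancel: "inverse (\<i> * of_real r) * (\<i> * of_real r * x) = x" for x :: complex
      using r by (simp add: complex_eq_iff power2_eq_square)
    \<comment> \<open>The integrand is the angular derivative of \<open>k\<close> on the circle, and
      both endpoints are the same point. Dividing by \<open>\<i> * of_real r\<close> shows that the
      A-part and the B-part of \<open>J' r\<close> have equal integrals, so \<open>J' r\<close> is
      twice \<open>I\<close>.\<close>
    have "((\<lambda>t. A (of_real r * cis t) * (\<i> * of_real r * cis t) - B (of_real r * cis t) * (\<i> * of_real r * cis (-t)))
        has_integral (k (of_real r * cis (2*pi)) - k (of_real r * cis 0))) {0..2*pi}"
    proof (rule fundamental_theorem_of_calculus)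
      fix t :: real
      have "((\<lambda>t. of_real r * cis t) has_derivative (\<lambda>h. h *\<^sub>R (\<i> * of_real r * cis t))) (at t)"
        unfolding has_vector_derivative_def[symmetric] cis_conv_exp
        by (auto intro!: derivative_eq_intros has_vector_derivative_real_field)
      from diff_chain_at[OF this k[OF inb[OF r']]]
      have "((\<lambda>t. k (of_real r * cis t)) has_vector_derivative
        A (of_real r * cis t) * (\<i> * of_real r * cis t) - B (of_real r * cis t) * (\<i> * of_real r * cis (-t))) (at t)"
        unfolding has_vector_derivative_def o_def
        by (rule has_derivative_eq_rhs) (simp add: fun_eq_iff scaleR_conv_of_real cis_cnj algebra_simps)
      thus "((\<lambda>t. k (of_real r * cis t)) has_vector_derivative
        A (of_real r * cis t) * (\<i> * of_real r * cis t) - B (of_real r * cis t) * (\<i> * of_real r * cis (-t))) (at t within {0..2*pi})"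
        by (rule has_vector_derivative_at_within)
    qed auto
    hence "((\<lambda>t. (\<i> * of_real r) * (A (of_real r * cis t) * cis t - B (of_real r * cis t) * cis (-t)))
        has_integral 0) {0..2*pi}"
      by (simp only: cis_2pi cis_zero diff_self) (simp add: algebra_simps)
    from has_integral_mult_right[OF this, of "inverse (\<i> * of_real r)"]
    have "((\<lambda>t. A (of_real r * cis t) * cis t - B (of_real r * cis t) * cis (-t)) has_integral 0) {0..2*pi}"
      by (simp only: cancel mult_zero_right)
    from has_integral_add[OF this has_integral_mult_right[OF iB, of 2]]
    have "J' r = 2 * I"
      unfolding J'_def by (intro integral_unique) (simp add: algebra_simps)
    \<comment> \<open>After multiplication by \<open>cis (-t)\<close>, the affine part of
      \<open>B\<close> has Fourier modes 0, -1 and -2; only the \<open>B1\<close> term, mode 0,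
      survives integration.\<close>
    have "((\<lambda>t. of_real r * B1 + B 0 * cis (of_int (-1) * t) + of_real r * B2 * cis (of_int (-2) * t))
       has_integral ((2*pi) *\<^sub>R (of_real r * B1) + B 0 * 0 + of_real r * B2 * 0)) {0..2*pi}"
      using has_integral_const_real[of "of_real r * B1" 0 "2*pi"]
      by (intro has_integral_add has_integral_mult_right integral_cis_multiple) auto
    from has_integral_diff[OF iB this]
    have iD: "((\<lambda>t. (B (of_real r * cis t) - B 0 - (B1 * (of_real r * cis t) + B2 * cnj (of_real r * cis t))) * cis (-t))
         has_integral (I - (2*pi*r) *\<^sub>R B1)) {0..2*pi}"
      (is "(?D has_integral _) _")
    proof (rule has_integral_eq_rhs[OF has_integral_eq, rotated])
      fix t
      have "cis t * cis (-t) = 1" by (simp add: cis_mult)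
      moreover have "cis (-t) * cis (-t) = cis (-2*t)" by (simp add: cis_mult)
      ultimately show "B (complex_of_real r * cis t) * cis (- t) -
         (complex_of_real r * B1 + B 0 * cis (real_of_int (- 1) * t) +
          complex_of_real r * B2 * cis (real_of_int (- 2) * t)) = ?D t"
        by (simp add: cis_cnj algebra_simps)
    qed (auto simp: scaleR_conv_of_real)
    have "cmod (I - (2*pi*r) *\<^sub>R B1) \<le> (\<delta> * r) * measure lborel (cbox 0 (2*pi))"
    proof (rule has_integral_bound[of _ ?D])
      show "cmod (?D t) \<le> \<delta> * r" for t
        using Bd[of "of_real r * cis t"] r r0 by (simp add: norm_mult)
    qed (use iD \<delta> r in auto)
    hence "\<bar>Re (I - (2*pi*r) *\<^sub>R B1)\<bar> \<le> 2 * pi * \<delta> * r"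
      using abs_Re_le_cmod[of "I - (2*pi*r) *\<^sub>R B1"] by (simp add: mult_ac)
    thus ?thesis using \<open>J' r = 2 * I\<close> by (simp add: algebra_simps)
  qed
  \<comment> \<open>\<open>2 * pi * E * r\<^sup>2\<close> is the integral of the barrier
    \<open>E * r\<^sup>2\<close> over the circle. The barrier forces \<open>G r0 \<le> G 0\<close>,
    while the mean value theorem and the bound on \<open>J'\<close> force the opposite strict
    inequality.\<close>
  define G where "G = (\<lambda>r. Re (J r) - 2 * pi * E * r\<^sup>2)"
  have "(G has_derivative (\<lambda>h. h * (Re (J' r) - 4 * pi * E * r))) (at r within {0..r0})" if "r \<in> {0..r0}" for r
    unfolding G_def using JJ'[OF that] unfolding has_vector_derivative_def
    by (auto intro!: derivative_eq_intros simp: fun_eq_iff algebra_simps)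
  from mvt_simple[OF r0(1), of G, OF this]
  obtain r where r: "r \<in> {0<..<r0}" "G r0 - G 0 = r0 * (Re (J' r) - 4 * pi * E * r)" by auto
  have "Re (J' r) - 4 * pi * E * r \<ge> 4 * pi * \<delta> * r"
    using Re_J'[of r] r(1) by (simp add: \<delta>_def field_simps)
  hence "G r0 - G 0 > 0"
    using r \<delta> r0 by (smt (verit) greaterThanLessThan_iff mult_pos_pos pi_gt_zero)
  moreover have "G r0 \<le> G 0"
  proof -
    have "(\<lambda>t. k (of_real r0 * cis t)) integrable_on {0..2*pi}"
      using r0 by (intro integrable_continuous_interval circ kc) auto
    from has_integral_Re[OF integrable_integral[OF this]]
    have "((\<lambda>t. Re (k (of_real r0 * cis t))) has_integral Re (J r0)) {0..2*pi}" by (simp add: J_def)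
    moreover have "((\<lambda>t. Re (k 0) + E * r0\<^sup>2) has_integral (2*pi) *\<^sub>R (Re (k 0) + E * r0\<^sup>2)) {0..2*pi}"
      using has_integral_const_real[of "Re (k 0) + E * r0\<^sup>2" 0 "2*pi"] by simp
    ultimately have "Re (J r0) \<le> (2*pi) *\<^sub>R (Re (k 0) + E * r0\<^sup>2)"
    proof (rule has_integral_le)
      show "Re (k (of_real r0 * cis t)) \<le> Re (k 0) + E * r0\<^sup>2" for t
        using E[OF inb[of r0 t]] r0 by (simp add: norm_mult)
    qed
    thus ?thesis by (simp add: G_def J_def algebra_simps)
  qed
  ultimately show False by simp
qed

section \<open>Inequalities at a point of contact\<close>

text \<open>Both \<open>k\<close> and the barrier vanish at 0, so they touch there. Contact
  determines \<open>A 0\<close>, and the explicit formula for the antiholomorphic coefficient makes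
  it differentiable although \<open>A\<close> is merely continuous. The left side is the real part
  of its z-derivative at 0.\<close>

lemma log_touching_inequality:
  fixes k A :: "complex \<Rightarrow> complex" and \<phi> b :: complex and \<alpha> s e \<rho> :: real
  assumes \<rho>: "\<rho> > 0" and s: "s \<ge> 0" and e: "e \<ge> 0" and k0: "k 0 = 0"
    and k: "\<And>z. z \<in> ball 0 \<rho> \<Longrightarrow>
      (k has_derivative (\<lambda>w. A z * w + \<phi> * exp (of_real (\<alpha> * Re (k z)) - k z) * cnj w)) (at z)"
    and A: "continuous_on (ball 0 \<rho>) A"
    and bound: "\<And>z. z \<in> ball 0 \<rho> \<Longrightarrow> Re (k z) \<le> s * ln ((cmod (1 + b * z))\<^sup>2 + e * (cmod z)\<^sup>2)"
  shows "Re (\<phi> * (cnj \<phi> - of_real ((2 - \<alpha>) * s) * b)) \<le> s * e"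
proof (rule field_le_epsilon)
  fix \<epsilon> :: real assume \<epsilon>: "\<epsilon> > 0"
  \<comment> \<open>The quadratic coefficient \<open>s * e / (cmod (1 + b * z))\<^sup>2\<close>
    equals \<open>s * e\<close> only in the limit at 0; the slack \<epsilon> makes \<open>E\<close>
    dominate it on a whole disc. Shrinking that disc also keeps \<open>1 + b * z\<close> off the
    branch cut of \<open>Ln\<close>.\<close>
  define E where "E = s * e + \<epsilon>"
  have "((\<lambda>z. s * e / (cmod (1 + b * z))\<^sup>2) \<longlongrightarrow> s * e / (cmod (1 + b * 0))\<^sup>2) (at 0)"
    by (intro tendsto_intros) auto
  moreover have "((\<lambda>z. Re (1 + b * z)) \<longlongrightarrow> Re (1 + b * 0)) (at 0)" by (intro tendsto_intros)
  ultimately have "\<forall>\<^sub>F z in at 0. s * e / (cmod (1 + b * z))\<^sup>2 < E \<and> Re (1 + b * z) > 0"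
    by (intro eventually_conj; elim order_tendstoD) (use \<epsilon> in \<open>auto simp: E_def\<close>)
  then obtain d where d: "d > 0"
    and dd: "\<And>z. z \<noteq> 0 \<Longrightarrow> cmod z < d \<Longrightarrow> s * e / (cmod (1 + b * z))\<^sup>2 < E \<and> Re (1 + b * z) > 0"
    unfolding eventually_at by auto
  define r where "r = min d \<rho>"
  have r: "r > 0" "ball 0 r \<subseteq> ball 0 \<rho>" using d \<rho> by (auto simp: r_def)
  have zE: "s * e / (cmod (1 + b * z))\<^sup>2 \<le> E" "Re (1 + b * z) > 0" if "z \<in> ball 0 r" for z
    using that dd[of z] \<epsilon> by (cases "z = 0"; auto simp: r_def E_def)+
  have nz: "1 + b * z \<noteq> 0" "1 + b * z \<notin> \<real>\<^sub>\<le>\<^sub>0" if "z \<in> ball 0 r" for z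
    using zE(2)[OF that] by (auto simp: complex_nonpos_Reals_iff simp del: plus_complex.sel)
  \<comment> \<open>Subtracting a holomorphic function changes neither dbar k nor the circle means,
      and turns the upper barrier into a purely quadratic one.\<close>
  define \<kappa> where "\<kappa> = (\<lambda>z. k z - of_real (2 * s) * Ln (1 + b * z))"
  define B where "B = (\<lambda>z. \<phi> * exp (of_real (\<alpha> * Re (k z)) - k z))"
  define A' where "A' = (\<lambda>z. A z - of_real (2 * s) * (b / (1 + b * z)))"
  have \<kappa>: "(\<kappa> has_derivative (\<lambda>w. A' z * w + B z * cnj w)) (at z)" if z: "z \<in> ball 0 r" for z
  proof -
    have z\<rho>: "z \<in> ball 0 \<rho>" using z r(2) by blast
    have "((\<lambda>z. of_real (2 * s) * Ln (1 + b * z)) has_field_derivative of_real (2 * s) * (b / (1 + b * z))) (at z)"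
      using nz[OF z] by (auto intro!: derivative_eq_intros simp: field_simps)
    from has_derivative_diff[OF k[OF z\<rho>] this[unfolded has_field_derivative_def]]
    show ?thesis unfolding \<kappa>_def A'_def B_def
      by (auto elim!: has_derivative_eq_rhs simp: algebra_simps fun_eq_iff)
  qed
  have kc: "continuous_on (ball 0 \<rho>) k"
    using k has_derivative_continuous by (blast intro: continuous_at_imp_continuous_on)
  have B: "continuous_on (ball 0 r) B"
    unfolding B_def using continuous_on_subset[OF kc r(2)] by (intro continuous_intros)
  have A': "continuous_on (ball 0 r) A'"
    unfolding A'_def using continuous_on_subset[OF A r(2)] nz by (intro continuous_intros) auto
  have \<kappa>0: "\<kappa> 0 = 0" by (simp add: \<kappa>_def k0)
  have \<kappa>_le: "Re (\<kappa> z) \<le> E * (cmod z)\<^sup>2" if z: "z \<in> ball 0 r" for z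
  proof -
    define m where "m = cmod (1 + b * z)"
    have m: "m > 0" using nz[OF z] by (simp add: m_def)
    \<comment> \<open>Factoring out \<open>m\<^sup>2\<close> separates the term
      \<open>2 * s * ln m\<close>, which is the real part of the subtracted logarithm; ln(1 + x)
      \<le> x bounds the rest quadratically.\<close>
    have "m\<^sup>2 + e * (cmod z)\<^sup>2 = m\<^sup>2 * (1 + e * (cmod z)\<^sup>2 / m\<^sup>2)" using m by (simp add: field_simps)
    hence "ln (m\<^sup>2 + e * (cmod z)\<^sup>2) = ln (m\<^sup>2) + ln (1 + e * (cmod z)\<^sup>2 / m\<^sup>2)"
      using m e by (simp add: ln_mult_pos add_pos_nonneg)
    also have "\<dots> \<le> 2 * ln m + e * (cmod z)\<^sup>2 / m\<^sup>2"
      using m e ln_add_one_self_le_self[of "e * (cmod z)\<^sup>2 / m\<^sup>2"] by (simp add: ln_realpow)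
    finally have "ln (m\<^sup>2 + e * (cmod z)\<^sup>2) - 2 * ln m \<le> e * (cmod z)\<^sup>2 / m\<^sup>2" by simp
    from mult_left_mono[OF this s] have "s * ln (m\<^sup>2 + e * (cmod z)\<^sup>2) - 2 * s * ln m \<le> (s * e / m\<^sup>2) * (cmod z)\<^sup>2"
      by (simp add: algebra_simps)
    also have "\<dots> \<le> E * (cmod z)\<^sup>2" using zE(1)[OF z] by (intro mult_right_mono) (auto simp: m_def)
    finally show ?thesis
      using bound[of z] subsetD[OF r(2) z] nz[OF z] by (simp add: \<kappa>_def m_def)
  qed
  \<comment> \<open>This function is at most 0 on the disc and vanishes at 0, so its differential at
    0 is zero. Testing with \<open>1\<close> and \<open>\<i>\<close> then yields
    \<open>A 0\<close>.\<close>
  have "((\<lambda>z. Re (\<kappa> z) - E * (cmod z)\<^sup>2) has_derivative (\<lambda>w. Re (A' 0 * w + B 0 * cnj w))) (at 0)"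
  proof -
    have "((\<lambda>z. (cmod z)\<^sup>2) has_derivative (\<lambda>w. 0)) (at (0::complex))"
      unfolding power2_norm_eq_inner by (auto intro!: derivative_eq_intros)
    from has_derivative_diff[OF has_derivative_Re[OF \<kappa>[of 0]] has_derivative_mult_right[OF this, of E]]
    show ?thesis using r by simp
  qed
  hence "(\<lambda>w. Re (A' 0 * w + B 0 * cnj w)) = (\<lambda>w. 0)"
    by (rule differential_zero_maxmin[where S="ball 0 r", rotated 2]) (use r \<kappa>_le \<kappa>0 in auto)
  hence grad: "Re (A' 0 * w + \<phi> * cnj w) = 0" for w by (simp add: B_def k0 fun_eq_iff)
  have A0: "A 0 = of_real (2 * s) * b - cnj \<phi>"
    using grad[of 1] grad[of \<i>] by (simp add: A'_def complex_eq_iff)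
  have "(B has_derivative (\<lambda>w. \<phi> * (of_real (\<alpha> * Re (A 0 * w + \<phi> * cnj w)) - (A 0 * w + \<phi> * cnj w)))) (at 0)"
  proof -
    have k': "(k has_derivative (\<lambda>w. A 0 * w + \<phi> * cnj w)) (at 0)" using k[of 0] \<rho> k0 by simp
    have "((\<lambda>z. of_real (\<alpha> * Re (k z)) - k z) has_derivative 
       (\<lambda>w. of_real (\<alpha> * Re (A 0 * w + \<phi> * cnj w)) - (A 0 * w + \<phi> * cnj w))) (at 0)"
      by (intro has_derivative_diff has_derivative_of_real has_derivative_mult_right has_derivative_Re k')
    from has_derivative_mult_right[OF diff_chain_at[OF this DERIV_exp[THEN has_field_derivative_imp_has_derivative]], of \<phi>]
    show ?thesis unfolding B_def by (simp add: o_def k0)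
  qed
  moreover have "\<phi> * (of_real (\<alpha> * Re (A 0 * w + \<phi> * cnj w)) - (A 0 * w + \<phi> * cnj w))
      = \<phi> * (cnj \<phi> - of_real ((2 - \<alpha>) * s) * b) * w + \<phi> * (of_real (\<alpha> * s) * cnj b - \<phi>) * cnj w" for w
  proof -
    \<comment> \<open>The terms \<open>cnj \<phi> * w\<close> and \<open>\<phi> * cnj w\<close> are
      conjugate, so their real parts cancel once \<open>A 0\<close> is substituted, leaving the real
      part of \<open>2 * s * b * w\<close>.\<close>
    have "of_real (\<alpha> * Re (A 0 * w + \<phi> * cnj w)) = of_real (\<alpha> * s) * (b * w + cnj (b * w))"
      unfolding A0 by (simp add: complex_eq_iff) (simp add: algebra_simps)
    thus ?thesis unfolding A0 by (simp add: algebra_simps)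
  qed
  ultimately have B': "(B has_derivative (\<lambda>w. \<phi> * (cnj \<phi> - of_real ((2 - \<alpha>) * s) * b) * w
      + \<phi> * (of_real (\<alpha> * s) * cnj b - \<phi>) * cnj w)) (at 0)" by simp
  show "Re (\<phi> * (cnj \<phi> - of_real ((2 - \<alpha>) * s) * b)) \<le> s * e + \<epsilon>"
    unfolding E_def[symmetric]
    by (rule Re_wirtinger_le_of_quadratic_bound[OF r(1) \<kappa> A' B B']) (simp_all add: \<kappa>0 \<kappa>_le)
qed

text \<open>Taking logarithms of the barrier normalised at \<open>z0\<close> reduces this to
  \<open>log_touching_inequality\<close> with s = 1/p, p = 2 - 2\<alpha>. Multiplying the result by
  p W, where W is the barrier value at \<open>z0\<close>, gives the stated form.\<close>

lemma touching_inequality: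
  fixes h :: "complex \<Rightarrow> complex" and \<alpha> C t :: real
  assumes \<alpha>: "\<alpha> < 1" and U: "open U" and h: "has_continuous_partials_on h U"
    and nz: "\<And>z. z \<in> U \<Longrightarrow> h z \<noteq> 0"
    and eq: "\<And>z. z \<in> U \<Longrightarrow> dbar h z = of_real (cmod (h z) powr \<alpha>)"
    and C: "C \<ge> 0" and t: "t \<ge> 0"
    and z0: "z0 \<in> U" and touch: "cmod (h z0) powr (2 - 2 * \<alpha>) = C * (cmod z0)\<^sup>2 + t"
    and le: "\<And>z. z \<in> U \<Longrightarrow> cmod (h z) powr (2 - 2 * \<alpha>) \<le> C * (cmod z)\<^sup>2 + t"
  shows "2 - 2 * \<alpha> \<le> (2 - \<alpha>) * (C * cmod z0 / sqrt (C * (cmod z0)\<^sup>2 + t)) + C * (t / (C * (cmod z0)\<^sup>2 + t))"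
proof -
  define W where "W = C * (cmod z0)\<^sup>2 + t"
  define p where "p = 2 - 2 * \<alpha>"
  have p: "p > 0" using \<alpha> by (simp add: p_def)
  have W: "W > 0" "cmod (h z0) powr p = W" using touch nz[OF z0] by (auto simp: W_def p_def simp flip: touch)
  have "continuous_on U h"
    using has_derivative_wirtinger[OF U h] has_derivative_continuous by (blast intro: continuous_at_imp_continuous_on)
  hence "isCont h z0" using U z0 continuous_on_eq_continuous_at by blast
  hence "((\<lambda>z. h z / h z0) \<longlongrightarrow> h z0 / h z0) (at z0)" 
    unfolding isCont_def by (intro tendsto_intros) (use nz z0 in auto)
  \<comment> \<open>Within distance 1 of 1 the quotient has positive real part, so the principal
    logarithm is differentiable along it.\<close>
  hence "\<forall>\<^sub>F z in at z0. dist (h z / h z0) 1 < 1" using nz[OF z0] tendstoD[of _ 1 _ 1] by simp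
  then obtain d1 where d1: "d1 > 0" "\<And>z. z \<noteq> z0 \<Longrightarrow> dist z z0 < d1 \<Longrightarrow> dist (h z / h z0) 1 < 1"
    unfolding eventually_at by auto
  obtain d2 where d2: "d2 > 0" "ball z0 d2 \<subseteq> U" using U z0 open_contains_ball by blast
  define \<rho> where "\<rho> = min d1 d2"
  have \<rho>: "\<rho> > 0" using d1 d2 by (simp add: \<rho>_def)
  have inU: "z0 + z \<in> U" if "z \<in> ball 0 \<rho>" for z using that d2 by (auto simp: \<rho>_def dist_norm)
  have slit: "h (z0 + z) / h z0 \<notin> \<real>\<^sub>\<le>\<^sub>0" if "z \<in> ball 0 \<rho>" for z
  proof -
    have "dist (h (z0 + z) / h z0) 1 < 1" 
      using d1(2)[of "z0 + z"] that nz[OF z0] by (cases "z = 0") (auto simp: \<rho>_def dist_norm)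
    hence "Re (h (z0 + z) / h z0) > 0"
      using abs_Re_le_cmod[of "h (z0 + z) / h z0 - 1"] by (simp add: dist_norm)
    thus ?thesis by (auto simp: complex_nonpos_Reals_iff)
  qed
  define k where "k = (\<lambda>z. Ln (h (z0 + z) / h z0))"
  define A where "A = (\<lambda>z. wirtinger_dz h (z0 + z) / h (z0 + z))"
  define \<phi> where "\<phi> = of_real (cmod (h z0) powr \<alpha>) / h z0"
  \<comment> \<open>Chosen by completing the square:
    \<open>(C * (cmod (z0 + z))\<^sup>2 + t) / W\<close> equals
    \<open>(cmod (1 + b * z))\<^sup>2 + e * (cmod z)\<^sup>2\<close>.\<close>
  define b where "b = of_real (C / W) * cnj z0"
  define e where "e = C * t / W\<^sup>2"
  have Re_k: "Re (k z) = ln (cmod (h (z0 + z)) / cmod (h z0))" if "z \<in> ball 0 \<rho>" for z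
    using nz[OF inU[OF that]] nz[OF z0] by (simp add: k_def norm_divide)
  have "Re (\<phi> * (cnj \<phi> - of_real ((2 - \<alpha>) * (1/p)) * b)) \<le> (1/p) * e"
  proof (rule log_touching_inequality[OF \<rho>])
    show "1/p \<ge> 0" "e \<ge> 0" "k 0 = 0" using p C t nz[OF z0] by (auto simp: e_def k_def)
    show "(k has_derivative (\<lambda>w. A z * w + \<phi> * exp (of_real (\<alpha> * Re (k z)) - k z) * cnj w)) (at z)"
      if z: "z \<in> ball 0 \<rho>" for z
    proof -
      let ?h = "h (z0 + z)"
      have "((\<lambda>z. z0 + z) has_derivative (\<lambda>w. w)) (at z)" by (auto intro!: derivative_eq_intros)
      from diff_chain_at[OF this has_derivative_wirtinger[OF U h inU[OF z]]]
      have "((\<lambda>z. h (z0 + z) / h z0) has_derivative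
          (\<lambda>w. (wirtinger_dz h (z0 + z) * w + dbar h (z0 + z) * cnj w) / h z0)) (at z)"
        unfolding o_def divide_inverse by (rule has_derivative_mult_left)
      from diff_chain_at[OF this has_field_derivative_imp_has_derivative[OF has_field_derivative_Ln[OF slit[OF z]]]]
      have "(k has_derivative (\<lambda>w. inverse (?h / h z0) * 
          ((wirtinger_dz h (z0 + z) * w + dbar h (z0 + z) * cnj w) / h z0))) (at z)"
        unfolding k_def o_def .
      moreover have "inverse (?h / h z0) * ((wirtinger_dz h (z0 + z) * w + dbar h (z0 + z) * cnj w) / h z0)
         = A z * w + (dbar h (z0 + z) / ?h) * cnj w" for w
        using nz[OF z0] nz[OF inU[OF z]] by (simp add: A_def field_simps)
      \<comment> \<open>The equation turns the quotient into |h|^\<alpha> / h; substituting h =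
        h(z0) exp k and |h| = |h(z0)| exp(Re k) expresses it through \<open>k\<close> alone.\<close>
      moreover have "dbar h (z0 + z) / ?h = \<phi> * exp (of_real (\<alpha> * Re (k z)) - k z)"
      proof -
        have "exp (k z) = ?h / h z0" using nz[OF z0] nz[OF inU[OF z]] by (simp add: k_def)
        moreover have "exp (\<alpha> * Re (k z)) = cmod ?h powr \<alpha> / cmod (h z0) powr \<alpha>"
          using nz[OF z0] nz[OF inU[OF z]] unfolding Re_k[OF z]
          by (simp add: powr_def ln_div exp_diff right_diff_distrib)
        hence "exp (complex_of_real (\<alpha> * Re (k z))) = of_real (cmod ?h powr \<alpha> / cmod (h z0) powr \<alpha>)"
          by (metis exp_of_real)
        ultimately show ?thesis using nz[OF z0] nz[OF inU[OF z]]
          by (simp add: exp_diff \<phi>_def eq[OF inU[OF z]])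
      qed
      ultimately show ?thesis by simp
    qed
    show "continuous_on (ball 0 \<rho>) A"
    proof -
      have "continuous_on U (wirtinger_dz h)"
        using h unfolding wirtinger_dz_def[abs_def] has_continuous_partials_on_def by (intro continuous_intros) auto
      hence "continuous_on U (\<lambda>z. wirtinger_dz h z / h z)"
        using nz \<open>continuous_on U h\<close> by (intro continuous_intros) auto
      thus ?thesis unfolding A_def 
      proof (rule continuous_on_compose2)
        show "(+) z0 ` ball 0 \<rho> \<subseteq> U" by (intro image_subsetI inU)
      qed (intro continuous_intros)
    qed
    show "Re (k z) \<le> 1 / p * ln ((cmod (1 + b * z))\<^sup>2 + e * (cmod z)\<^sup>2)" if z: "z \<in> ball 0 \<rho>" for z
    proof -
      have "(cmod (1 + b * z))\<^sup>2 + e * (cmod z)\<^sup>2 = (C * (cmod (z0 + z))\<^sup>2 + t) / W"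
      proof -
        have "(cmod (1 + b * z))\<^sup>2 = 1 + 2 * (C / W) * Re (cnj z0 * z) + (C/W)\<^sup>2 * (cmod z0)\<^sup>2 * (cmod z)\<^sup>2"
          unfolding cmod_power2 by (simp add: b_def) algebra
        moreover have "(cmod (z0 + z))\<^sup>2 = (cmod z0)\<^sup>2 + 2 * Re (cnj z0 * z) + (cmod z)\<^sup>2"
          unfolding cmod_power2 by simp algebra
        moreover have "(C/W)\<^sup>2 * (cmod z0)\<^sup>2 * (cmod z)\<^sup>2 + e * (cmod z)\<^sup>2 = (C / W\<^sup>2) * (C * (cmod z0)\<^sup>2 + t) * (cmod z)\<^sup>2"
          by (simp add: e_def power2_eq_square algebra_simps add_divide_distrib)
        moreover have "\<dots> = (C / W) * (cmod z)\<^sup>2" 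
          unfolding W_def[symmetric] using W(1) by (simp add: power2_eq_square)
        ultimately have "(cmod (1 + b * z))\<^sup>2 + e * (cmod z)\<^sup>2 = 1 + (C / W) * ((cmod (z0 + z))\<^sup>2 - (cmod z0)\<^sup>2)"
          by (simp add: algebra_simps)
        also have "\<dots> = (W + C * ((cmod (z0 + z))\<^sup>2 - (cmod z0)\<^sup>2)) / W" using W(1) by (simp add: field_simps)
        also have "W + C * ((cmod (z0 + z))\<^sup>2 - (cmod z0)\<^sup>2) = C * (cmod (z0 + z))\<^sup>2 + t"
          by (simp add: W_def algebra_simps)
        finally show ?thesis .
      qed
      moreover have "p * Re (k z) = ln (cmod (h (z0 + z)) powr p / W)"
        using nz[OF inU[OF z]] nz[OF z0] unfolding W(2)[symmetric] Re_k[OF z] by (simp add: ln_div ln_powr right_diff_distrib)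
      moreover have "\<dots> \<le> ln ((C * (cmod (z0 + z))\<^sup>2 + t) / W)"
        using le[OF inU[OF z]] nz[OF inU[OF z]] W(1) 
        by (intro ln_mono) (auto simp: p_def divide_right_mono intro!: divide_pos_pos)
      ultimately show ?thesis using p by (simp add: field_simps)
    qed
  qed
  \<comment> \<open>The modulus is |h(z0)|^(\<alpha> - 1), and the exponent \<alpha> - 1 is
    -p/2.\<close>
  moreover have \<phi>2: "cmod \<phi> = 1 / sqrt W"
  proof -
    have "cmod \<phi> = cmod (h z0) powr \<alpha> / cmod (h z0) powr 1" using nz[OF z0] by (simp add: \<phi>_def norm_divide)
    also have "\<dots> = cmod (h z0) powr (\<alpha> - 1)" by (rule powr_diff[symmetric])
    also have "\<alpha> - 1 = - (p * (1/2))" by (simp add: p_def field_simps)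
    moreover have "cmod (h z0) powr (p * (1/2)) = sqrt W"
      using powr_powr[of "cmod (h z0)" p "1/2"] W by (simp add: powr_half_sqrt)
    hence "cmod (h z0) powr (- (p * (1/2))) = 1 / sqrt W" by (simp only: powr_minus inverse_eq_divide)
    ultimately show ?thesis by simp
  qed
  moreover have "Re (\<phi> * (cnj \<phi> - of_real ((2 - \<alpha>) * (1/p)) * b)) = (cmod \<phi>)\<^sup>2 - ((2 - \<alpha>) / p) * Re (\<phi> * b)"
    unfolding cmod_power2 by (simp add: power2_eq_square field_simps)
  \<comment> \<open>The arguments of \<open>\<phi>\<close> and \<open>b\<close> are unrelated, so
    the product is estimated by moduli; this leaves an inequality in \<open>cmod z0\<close>
    only.\<close>
  moreover have "((2 - \<alpha>) / p) * Re (\<phi> * b) \<le> ((2 - \<alpha>) / p) * (1 / sqrt W * (C * cmod z0 / W))"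
  proof (rule mult_left_mono)
    have "Re (\<phi> * b) \<le> cmod \<phi> * cmod b" using complex_Re_le_cmod[of "\<phi> * b"] by (simp add: norm_mult)
    also have "cmod b = C * cmod z0 / W" using C W by (simp add: b_def norm_mult norm_divide)
    finally show "Re (\<phi> * b) \<le> 1 / sqrt W * (C * cmod z0 / W)" unfolding \<phi>2 .
  qed (use \<alpha> p in auto)
  ultimately have "1 / W - ((2 - \<alpha>) / p) * (1 / sqrt W * (C * cmod z0 / W)) \<le> (1/p) * e"
    using W(1) by (simp add: power_divide)
  hence "p * W * (1 / W - ((2 - \<alpha>) / p) * (1 / sqrt W * (C * cmod z0 / W))) \<le> p * W * ((1/p) * e)"
    using p W by (intro mult_left_mono) auto
  moreover have "p * W * ((1/p) * e) = C * (t / W)" using p W by (simp add: e_def power2_eq_square)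
  moreover have "p * W * (1 / W - ((2 - \<alpha>) / p) * (1 / sqrt W * (C * cmod z0 / W))) = p - (2 - \<alpha>) * (C * cmod z0 / sqrt W)"
    using p W by (simp add: right_diff_distrib)
  ultimately show ?thesis unfolding W_def[symmetric] p_def[symmetric] by linarith
qed

section \<open>Estimates for the constant\<close>

text \<open>The power cancels the outer exponent of \<open>S_const\<close>. What remains is
  \<alpha>(2 - \<alpha>)^2 \<le> 4(1 - \<alpha>) on the first branch and \<alpha>(2 - \<alpha>)
  \<le> 1 on the second.\<close>

lemma S_const_powr_le:
  assumes "0 < \<alpha>" "\<alpha> < 1"
  shows "S_const \<alpha> powr (2 - 2 * \<alpha>) \<le> ((2 - 2 * \<alpha>) / (2 - \<alpha>))\<^sup>2"
proof (cases "\<alpha> \<le> 2/3")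
  case True
  \<comment> \<open>Expanded, the claim is \<alpha>^3 \<le> 4(1 - \<alpha>)^2; for \<alpha> \<le>
    2/3 the left side is at most 8/27 and the right side at least 4/9.\<close>
  have "\<alpha> ^ 3 \<le> (2/3) ^ 3" using assms True by (intro power_mono) auto
  moreover have "(1/3)\<^sup>2 \<le> (1 - \<alpha>)\<^sup>2" using True by (intro power_mono) auto
  ultimately have "\<alpha> * (2 - \<alpha>)\<^sup>2 \<le> 4 * (1 - \<alpha>)"
    by (simp add: power2_eq_square power3_eq_cube algebra_simps)
  hence "(1 - \<alpha>) * (\<alpha> * (2 - \<alpha>)\<^sup>2) \<le> (1 - \<alpha>) * (4 * (1 - \<alpha>))"
    using assms by (intro mult_left_mono) auto
  also have "\<dots> = (2 - 2 * \<alpha>)\<^sup>2" by algebra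
  finally have "\<alpha> * (1 - \<alpha>) * (2 - \<alpha>)\<^sup>2 \<le> (2 - 2 * \<alpha>)\<^sup>2" by (simp only: mult_ac)
  hence "\<alpha> * (1 - \<alpha>) \<le> (2 - 2 * \<alpha>)\<^sup>2 / (2 - \<alpha>)\<^sup>2"
    using assms by (subst pos_le_divide_eq) auto
  thus ?thesis using assms True by (simp add: S_const_def powr_powr power_divide)
next
  case False
  have "\<alpha> * (2 - \<alpha>) \<le> 1" using zero_le_power2[of "1 - \<alpha>"] by (simp add: power2_eq_square algebra_simps)
  hence "4 * (1 - \<alpha>)\<^sup>2 * (\<alpha> * (2 - \<alpha>)) \<le> 4 * (1 - \<alpha>)\<^sup>2 * 1" by (intro mult_left_mono) auto
  also have "\<dots> = (2 - 2 * \<alpha>)\<^sup>2" by (simp add: power2_eq_square algebra_simps)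
  finally have "4 * (1 - \<alpha>)\<^sup>2 * (\<alpha> * (2 - \<alpha>)) / (2 - \<alpha>)\<^sup>2 \<le> (2 - 2 * \<alpha>)\<^sup>2 / (2 - \<alpha>)\<^sup>2"
    by (rule divide_right_mono) simp
  moreover have "4 * (1 - \<alpha>)\<^sup>2 * (\<alpha> * (2 - \<alpha>)) / (2 - \<alpha>)\<^sup>2 = 4 * \<alpha> * (1 - \<alpha>)\<^sup>2 / (2 - \<alpha>)"
    using assms by (simp add: power2_eq_square[of "2 - \<alpha>"])
  moreover have "4 * \<alpha> * (1 - \<alpha>)\<^sup>2 / (2 - \<alpha>) > 0" using assms by simp
  ultimately show ?thesis using assms False by (simp add: S_const_def powr_powr power_divide)
qed

text \<open>
  With y = sqrt C * r / sqrt W and W = C r^2 + t, the left side is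
  (2 - \<alpha>) sqrt C y + C (1 - y^2), which increases in y on [0, 1].
\<close>

lemma touching_inequality_fails:
  fixes \<alpha> C t r :: real
  assumes \<alpha>: "0 < \<alpha>" "\<alpha> < 1" and C: "C > 0" "C \<le> ((2 - 2 * \<alpha>) / (2 - \<alpha>))\<^sup>2" and t: "t > 0" and r: "r \<ge> 0"
  shows "(2 - \<alpha>) * (C * r / sqrt (C * r\<^sup>2 + t)) + C * (t / (C * r\<^sup>2 + t)) < 2 - 2 * \<alpha>"
proof -
  define W where "W = C * r\<^sup>2 + t"
  define q where "q = sqrt C"
  define y where "y = q * r / sqrt W"
  have W: "W > 0" using C t by (simp add: W_def add_nonneg_pos)
  have q: "q > 0" "q\<^sup>2 = C" using C by (auto simp: q_def)
  have y2: "y\<^sup>2 = C * r\<^sup>2 / W" using W q by (simp add: y_def power_divide power_mult_distrib)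
  have tW: "t / W = 1 - y\<^sup>2" unfolding y2 using W by (simp add: field_simps W_def)
  have y0: "y \<ge> 0" using q r W by (simp add: y_def)
  have y1: "y < 1"
  proof -
    have "t / W > 0" using t W by simp
    hence "y\<^sup>2 < 1\<^sup>2" using tW by simp
    thus ?thesis by (rule power2_less_imp_less) simp
  qed
  have qle: "q \<le> (2 - 2 * \<alpha>) / (2 - \<alpha>)"
    using C \<alpha> unfolding q_def by (intro real_le_lsqrt) auto
  hence 1: "(2 - \<alpha>) * q \<le> 2 - 2 * \<alpha>" using \<alpha> by (simp add: field_simps)
  \<comment> \<open>Monotonicity on [0, 1] needs 2q \<le> 2 - \<alpha>; it follows from the bound on
    \<open>q\<close> because 4(1 - \<alpha>) = (2 - \<alpha>)^2 - \<alpha>^2.\<close>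
  have "(2 - \<alpha>) * (2 * q) \<le> 2 * (2 - 2 * \<alpha>)" using 1 by simp
  also have "\<dots> \<le> (2 - \<alpha>) * (2 - \<alpha>)"
    using zero_le_power2[of \<alpha>] by (simp add: power2_eq_square algebra_simps)
  finally have "2 * q \<le> 2 - \<alpha>" using \<alpha> by simp
  moreover have "q * y < q * 1" using q y1 by (intro mult_strict_left_mono) auto
  ultimately have "q * (1 + y) < 2 - \<alpha>" by (simp add: algebra_simps)
  \<comment> \<open>The value at 1 minus the value at y is q(1 - y)(2 - \<alpha> - q(1 + y)), and
    the value at 1 is (2 - \<alpha>)q, at most 2 - 2\<alpha>.\<close>
  hence "(q * (1 - y)) * (q * (1 + y)) < (q * (1 - y)) * (2 - \<alpha>)"
    using q y1 by (intro mult_strict_left_mono) auto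
  hence "(2 - \<alpha>) * (q * y) + q\<^sup>2 * (1 - y\<^sup>2) < (2 - \<alpha>) * q"
    by (simp add: power2_eq_square algebra_simps)
  moreover have "C * r / sqrt W = q * y" using q by (simp add: y_def power2_eq_square flip: q(2))
  ultimately show ?thesis using 1 unfolding W_def[symmetric] tW q(2) by simp
qed

section \<open>The interior maximum and the contradiction\<close>

theorem theorem1p1:
  fixes \<alpha> :: real and h :: "complex \<Rightarrow> complex"
  assumes "0 < \<alpha>" and "\<alpha> < 1"
    and "continuous_on (cball 0 1) h"
    and "has_continuous_partials_on h {z. cmod z < 1 \<and> h z \<noteq> 0}"
    and "\<And>z. cmod z < 1 \<Longrightarrow> h z \<noteq> 0 \<Longrightarrow> dbar h z = of_real (cmod (h z) powr \<alpha>)"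
    and "h 0 \<noteq> 0"
  shows "(SUP z\<in>ball 0 1. cmod (h z)) > S_const \<alpha>"
proof (rule ccontr)
  assume neg: "\<not> (SUP z\<in>ball 0 1. cmod (h z)) > S_const \<alpha>"
  define S where "S = S_const \<alpha>"
  define p where "p = 2 - 2 * \<alpha>"
  define C where "C = S powr p"
  have S: "S > 0" using S_const_pos assms(1,2) by (simp add: S_def)
  have p: "p > 0" using assms(2) by (simp add: p_def)
  have C: "C > 0" "C \<le> ((2 - 2 * \<alpha>) / (2 - \<alpha>))\<^sup>2"
    using S S_const_powr_le[OF assms(1,2)] by (auto simp: C_def S_def p_def)
  \<comment> \<open>The real supremum bounds the values only for a set bounded above; compactness of
    the closed disc supplies this.\<close>
  have "continuous_on (cball 0 1) (\<lambda>z. cmod (h z))" using assms(3) by (intro continuous_intros)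
  hence "bounded ((\<lambda>z. cmod (h z)) ` cball 0 1)"
    by (intro compact_imp_bounded compact_continuous_image) auto
  hence "bdd_above ((\<lambda>z. cmod (h z)) ` ball 0 1)"
    by (intro bdd_above_mono[OF bounded_imp_bdd_above] image_mono) auto
  hence "cmod (h z) \<le> S" if "z \<in> ball 0 1" for z
    using cSUP_upper[OF that] neg unfolding S_def by (meson not_less order_trans)
  \<comment> \<open>The supremum runs over the open disc, but the sign of \<open>F\<close> on the
    unit circle requires the bound there too; continuity extends it.\<close>
  hence hS: "cmod (h z) \<le> S" if "z \<in> cball 0 1" for z
    using continuous_on_closure_norm_le[of "ball 0 1" h S z] assms(3) that by simp
  define F where "F = (\<lambda>z. cmod (h z) powr p - C * (cmod z)\<^sup>2)"
  have "continuous_on (cball 0 1) F"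
    unfolding F_def using assms(3) p by (intro continuous_intros continuous_on_powr') auto
  then obtain z0 where z0: "z0 \<in> cball 0 1" and max: "\<And>z. z \<in> cball 0 1 \<Longrightarrow> F z \<le> F z0"
    using continuous_attains_sup[of "cball (0::complex) 1" F] by auto
  have "0 < F 0" using assms(6) by (simp add: F_def)
  also have "\<dots> \<le> F z0" by (rule max) simp
  finally have t: "F z0 > 0" .
  have "h z0 \<noteq> 0" 
  proof
    assume "h z0 = 0"
    hence "F z0 = - (C * (cmod z0)\<^sup>2)" by (simp add: F_def)
    thus False using t C(1) by (simp add: mult_less_0_iff)
  qed
  moreover have "cmod z0 < 1"
  proof (rule ccontr)
    assume "\<not> cmod z0 < 1"
    hence "cmod z0 = 1" using z0 by simp
    hence "F z0 = cmod (h z0) powr p - S powr p" by (simp add: F_def C_def)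
    also have "\<dots> \<le> 0" using hS[OF z0] p by (simp add: powr_mono2)
    finally show False using t by simp
  qed
  ultimately have z0U: "z0 \<in> {z. cmod z < 1 \<and> h z \<noteq> 0}" by simp
  have "open (ball 0 1 \<inter> h -` (- {0}))"
    by (rule continuous_open_preimage[OF continuous_on_subset[OF assms(3)]]) auto
  moreover have "ball 0 1 \<inter> h -` (- {0}) = {z. cmod z < 1 \<and> h z \<noteq> 0}" by auto
  ultimately have U: "open {z. cmod z < 1 \<and> h z \<noteq> 0}" by simp
  \<comment> \<open>With t equal to the maximum \<open>F z0\<close>, the barrier C|z|^2 + t lies
    above |h|^p throughout the open set and meets it at \<open>z0\<close>.\<close>
  have "2 - 2 * \<alpha> \<le> (2 - \<alpha>) * (C * cmod z0 / sqrt (C * (cmod z0)\<^sup>2 + F z0)) + C * (F z0 / (C * (cmod z0)\<^sup>2 + F z0))"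
  proof (rule touching_inequality[OF assms(2) U assms(4)])
    fix z assume "z \<in> {z. cmod z < 1 \<and> h z \<noteq> 0}"
    hence "F z \<le> F z0" by (intro max) auto
    thus "cmod (h z) powr (2 - 2 * \<alpha>) \<le> C * (cmod z)\<^sup>2 + F z0" by (simp add: F_def p_def)
  qed (use assms(5) C t z0U in \<open>auto simp: F_def p_def\<close>)
  with touching_inequality_fails[OF assms(1,2) C t, of "cmod z0"] show False by simp
qed

end
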